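(* Let $G$ be a graph on $n\ge 2$ vertices, let $v$ be a vertex of $G$, and let $G' = G - v$ be the graph obtained from $G$ by deleting $v$ and all edges incident to it. Then $\mathrm{USN}(G)-(n-1)\le \mathrm{USN}(G')\le \mathrm{USN}(G)$.
   Context: Graphs are finite, simple and undirected. A valid labelling of a graph $G$ with universe a finite set $S$ assigns to the vertices of $G$ pairwise distinct nonempty subsets of $S$ such that two distinct vertices are adjacent if and only if their labels are disjoint. The universe size number $\mathrm{USN}(G)$ is the minimum of $|S|$ over all finite sets $S$ for which $G$ has a valid labelling with universe $S$. *)

theory Defs
  imports "Graph_Theory.Digraph"
begin

text \<open>
  A finite simple undirected graph is an instance of the locale \<^locale>\<open>graph\<close>: a finite,
  loop-free digraph without parallel arcs whose adjacency relation is symmetric.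
  Adjacency of \<open>u\<close> and \<open>w\<close> is \<open>u \<rightarrow>\<^bsub>G\<^esub> w\<close>.
\<close>

definition valid_labelling :: "('a, 'b) pre_digraph \<Rightarrow> 'c set \<Rightarrow> ('a \<Rightarrow> 'c set) \<Rightarrow> bool" where
  "valid_labelling G S f \<longleftrightarrow>
     finite S \<and>
     (\<forall>u\<in>verts G. f u \<subseteq> S \<and> f u \<noteq> {}) \<and>
     inj_on f (verts G) \<and>
     (\<forall>u\<in>verts G. \<forall>w\<in>verts G. u \<noteq> w \<longrightarrow> (u \<rightarrow>\<^bsub>G\<^esub> w \<longleftrightarrow> f u \<inter> f w = {}))"

text \<open>
  The minimum ranges over universes consisting of natural numbers. This loses no generality
  (lemma \<open>valid_labelling_nat\<close>), and the minimum is attained (lemma \<open>usn_attained\<close>).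
\<close>

definition usn :: "('a, 'b) pre_digraph \<Rightarrow> nat" where
  "usn G = (LEAST k. \<exists>(S :: nat set) f. valid_labelling G S f \<and> card S = k)"

lemma valid_labelling_nat:
  fixes S :: "'c set"
  assumes "valid_labelling G S f"
  shows "\<exists>(T :: nat set) g. valid_labelling G T g \<and> card T = card S"
proof -
  have fin: "finite S" and sub: "\<And>u. u \<in> verts G \<Longrightarrow> f u \<subseteq> S"
    using assms by (auto simp: valid_labelling_def)
  obtain h :: "'c \<Rightarrow> nat" where h: "inj_on h S"
    using finite_imp_inj_to_nat_seg[OF fin] by blast
  have disj: "h ` f u \<inter> h ` f w = {} \<longleftrightarrow> f u \<inter> f w = {}"
    if "u \<in> verts G" "w \<in> verts G" for u w
    using inj_on_image_Int[OF h sub[OF that(1)] sub[OF that(2)]] by (metis image_is_empty)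
  have inj: "inj_on (\<lambda>u. h ` f u) (verts G)"
    using assms inj_on_image_eq_iff[OF h] sub by (auto simp: valid_labelling_def inj_on_def)
  have "valid_labelling G (h ` S) (\<lambda>u. h ` f u)"
    using assms inj disj sub by (simp add: valid_labelling_def image_mono)
  then show ?thesis
    using card_image[OF h] by blast
qed

lemma (in graph) usn_attained:
  "\<exists>(S :: nat set) f. valid_labelling G S f \<and> card S = usn G"
proof -
  define f where "f u = {{u, w} | w. w \<in> verts G \<and> \<not> u \<rightarrow>\<^bsub>G\<^esub> w}" for u
  have loop: "\<not> u \<rightarrow>\<^bsub>G\<^esub> u" for u
    using no_loops by (auto simp: arcs_ends_conv)
  have sym: "u \<rightarrow>\<^bsub>G\<^esub> w \<longleftrightarrow> w \<rightarrow>\<^bsub>G\<^esub> u" for u w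
    using sym_arcs by (auto simp: symmetric_def sym_def)
  have self: "{u} \<in> f w \<longleftrightarrow> u = w" if "u \<in> verts G" for u w
    using that loop by (auto simp: f_def)
  have sub: "f u \<subseteq> Pow (verts G)" if "u \<in> verts G" for u
    using that by (auto simp: f_def)
  have disj: "u \<rightarrow>\<^bsub>G\<^esub> w \<longleftrightarrow> f u \<inter> f w = {}"
    if "u \<in> verts G" "w \<in> verts G" "u \<noteq> w" for u w
  proof
    assume "u \<rightarrow>\<^bsub>G\<^esub> w"
    then show "f u \<inter> f w = {}"
      using that sym[of u w] by (auto simp: f_def doubleton_eq_iff)
  next
    assume "f u \<inter> f w = {}"
    moreover have "{u, w} \<in> f u \<inter> f w" if "\<not> u \<rightarrow>\<^bsub>G\<^esub> w"
      using that sym[of u w] \<open>u \<in> verts G\<close> \<open>w \<in> verts G\<close>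
      by (auto simp: f_def doubleton_eq_iff)
    ultimately show "u \<rightarrow>\<^bsub>G\<^esub> w" by blast
  qed
  have "inj_on f (verts G)"
    using self by (metis inj_onI)
  moreover have "f u \<noteq> {}" if "u \<in> verts G" for u
    using self[OF that, of u] by auto
  ultimately have "valid_labelling G (Pow (verts G)) f"
    using sub disj by (auto simp: valid_labelling_def)
  from valid_labelling_nat[OF this]
  have "\<exists>k. \<exists>(S :: nat set) f. valid_labelling G S f \<and> card S = k"
    by blast
  then show ?thesis
    unfolding usn_def by (rule LeastI_ex)
qed

end

theory Submission
  imports Defs
begin

text \<open>
  Restricting a labelling of \<open>G\<close> to \<open>G - v\<close> gives the upper bound. Conversely, extend a labelling
  of \<open>G - v\<close> by one fresh element for each vertex not adjacent to \<open>v\<close>: add it to the label of that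
  vertex, and label \<open>v\<close> with the set of all fresh elements. Using a separate element per vertex
  leaves all old intersections unchanged. If \<open>v\<close> is adjacent to every other vertex, a single fresh
  element labels \<open>v\<close>, and \<open>1 \<le> n - 1\<close> because \<open>n \<ge> 2\<close>.
\<close>

text \<open>The element type of \<open>S\<close> is arbitrary, so universes built from sum types may
  be used below.\<close>

lemma usn_le_card:
  assumes "valid_labelling G S f"
  shows "usn G \<le> card S"
  using valid_labelling_nat[OF assms] unfolding usn_def by (metis (mono_tags, lifting) Least_le)

lemma dominates_del_vert_iff:
  "u \<rightarrow>\<^bsub>pre_digraph.del_vert G v\<^esub> w \<longleftrightarrow> u \<rightarrow>\<^bsub>G\<^esub> w \<and> u \<noteq> v \<and> w \<noteq> v"
  by (auto simp: arcs_ends_def arc_to_ends_def pre_digraph.del_vert_def)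

lemma valid_labelling_del_vert:
  assumes "valid_labelling G S f"
  shows "valid_labelling (pre_digraph.del_vert G v) S f"
  using assms
  by (auto simp: valid_labelling_def dominates_del_vert_iff pre_digraph.verts_del_vert
      intro: inj_on_subset)

lemma (in graph) usn_le_usn_del_vert:
  assumes "v \<in> verts G" and "card (verts G) \<ge> 2"
  shows "usn G \<le> usn (del_vert v) + (card (verts G) - 1)"
proof -
  \<comment> \<open>Restricting a labelling of \<open>G\<close> shows that the set minimised in
    \<open>usn (del_vert v)\<close> is nonempty, so the minimum is attained.\<close>
  obtain S0 :: "nat set" and f0 where "valid_labelling G S0 f0"
    using usn_attained by blast
  then have "valid_labelling (del_vert v) S0 f0"
    by (rule valid_labelling_del_vert)
  then have "\<exists>k (S :: nat set) f. valid_labelling (del_vert v) S f \<and> card S = k"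
    by blast
  from LeastI_ex[OF this] obtain S :: "nat set" and f
    where lab: "valid_labelling (del_vert v) S f" and card_S: "card S = usn (del_vert v)"
    unfolding usn_def by blast
  \<comment> \<open>The non-neighbours themselves, tagged by \<open>Inr\<close>, serve as fresh
    elements. If there are none, \<open>{v}\<close> keeps the label of \<open>v\<close> nonempty and
    still misses every other label.\<close>
  define W where "W = {w \<in> verts G - {v}. \<not> v \<rightarrow>\<^bsub>G\<^esub> w}"
  define N where "N = (if W = {} then {v} else W)"
  define g where "g u = (if u = v then Inr ` N else Inl ` f u \<union> Inr ` ({u} \<inter> W))" for u
  have sym: "u \<rightarrow>\<^bsub>G\<^esub> w \<longleftrightarrow> w \<rightarrow>\<^bsub>G\<^esub> u" for u w
    using sym_arcs by (auto simp: symmetric_def sym_def)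
  have finS: "finite S"
    and f: "\<And>u. \<lbrakk>u \<in> verts G; u \<noteq> v\<rbrakk> \<Longrightarrow> f u \<subseteq> S \<and> f u \<noteq> {}"
    and inj: "\<And>u w. \<lbrakk>u \<in> verts G; w \<in> verts G; u \<noteq> v; w \<noteq> v; f u = f w\<rbrakk> \<Longrightarrow> u = w"
    and adj: "\<And>u w. \<lbrakk>u \<in> verts G; w \<in> verts G; u \<noteq> v; w \<noteq> v; u \<noteq> w\<rbrakk>
      \<Longrightarrow> u \<rightarrow>\<^bsub>G\<^esub> w \<longleftrightarrow> f u \<inter> f w = {}"
    using lab by (auto simp: valid_labelling_def dominates_del_vert_iff verts_del_vert inj_on_def)
  have W: "W \<subseteq> verts G - {v}"
    by (auto simp: W_def)
  have finN: "finite N" and "N \<noteq> {}"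
    using W finite_subset[OF W] by (auto simp: N_def)
  have vg: "v \<rightarrow>\<^bsub>G\<^esub> w \<longleftrightarrow> g v \<inter> g w = {}" if "w \<in> verts G" "w \<noteq> v" for w
    using that by (auto simp: g_def N_def W_def)
  \<comment> \<open>The \<open>Inl\<close> part recovers the old label. It is empty only at
    \<open>v\<close>, since old labels are nonempty; hence \<open>g\<close> is injective.\<close>
  have Inl_g: "Inl -` g u = (if u = v then {} else f u)" for u
    by (auto simp: g_def)
  have "inj_on g (verts G)"
  proof (rule inj_onI)
    fix u w assume uw: "u \<in> verts G" "w \<in> verts G" "g u = g w"
    then have "(if u = v then {} else f u) = (if w = v then {} else f w)"
      using Inl_g by metis
    then show "u = w"
      using uw(1,2) f inj by (metis (full_types))
  qed
  moreover have "g u \<subseteq> Inl ` S \<union> Inr ` N \<and> g u \<noteq> {}" if "u \<in> verts G" for u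
  proof (cases "u = v")
    case False
    moreover have "{u} \<inter> W \<subseteq> N"
      by (auto simp: N_def)
    ultimately show ?thesis
      using f[OF that] by (auto simp: g_def)
  qed (use \<open>N \<noteq> {}\<close> in \<open>auto simp: g_def\<close>)
  moreover have "u \<rightarrow>\<^bsub>G\<^esub> w \<longleftrightarrow> g u \<inter> g w = {}"
    if "u \<in> verts G" "w \<in> verts G" "u \<noteq> w" for u w
  proof -
    consider "u = v" | "w = v" | "u \<noteq> v" "w \<noteq> v" by blast
    then show ?thesis
    proof cases
      case 1
      then show ?thesis using vg that by blast
    next
      case 2
      then show ?thesis using vg that sym by (metis inf_commute)
    next
      case 3
      \<comment> \<open>The \<open>Inr\<close> parts lie in \<open>{u}\<close> and
        \<open>{w}\<close>, hence are disjoint.\<close>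
      then have "g u \<inter> g w = Inl ` (f u \<inter> f w)"
        using \<open>u \<noteq> w\<close> by (auto simp: g_def)
      then show ?thesis using adj that 3 by simp
    qed
  qed
  ultimately have "valid_labelling G (Inl ` S \<union> Inr ` N) g"
    using finS finN by (simp add: valid_labelling_def)
  then have "usn G \<le> card (Inl ` S \<union> Inr ` N :: (nat + 'a) set)"
    by (rule usn_le_card)
  also have "\<dots> = card S + card N"
    using finS finN by (simp add: card_Plus flip: Plus_def)
  also have "card N \<le> card (verts G) - 1"
    using card_mono[OF _ W] assms by (auto simp: N_def)
  finally show ?thesis
    using card_S by simp
qed

theorem theorem17:
  fixes G :: "('a, 'b) pre_digraph" and v :: 'a and n :: nat
  assumes "graph G"
    and "card (verts G) = n" and "n \<ge> 2"
    and "v \<in> verts G"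
  shows "int (usn G) - (int n - 1) \<le> int (usn (pre_digraph.del_vert G v))
    \<and> usn (pre_digraph.del_vert G v) \<le> usn G"
proof
  interpret graph G by fact
  \<comment> \<open>As n \<ge> 2, truncated and integer subtraction of 1 agree.\<close>
  show "int (usn G) - (int n - 1) \<le> int (usn (del_vert v))"
    using usn_le_usn_del_vert[of v] assms by linarith
  obtain S :: "nat set" and f where "valid_labelling G S f" "card S = usn G"
    using usn_attained by blast
  then show "usn (del_vert v) \<le> usn G"
    using usn_le_card valid_labelling_del_vert by metis
qed

end
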